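(* Let $p$ and $q$ be probability density functions in $\mathcal{G}$ with respective supports $S_q\subseteq S_p$. Let $l$ be a real-valued function such that $\mathrm{E}_p[l(X)]$ and $\mathrm{E}_q[l(X)]$ exist; also suppose that there exists $f\in\mathcal{F}(p)\cap\mathcal{F}(q)$ such that $$\mathcal{T}_pf(x)=\left(l(x)-\mathrm{E}_p[l(X)]\right)\mathbb{I}_{S_p}(x);$$ denote this function by $f_l^p$. Then $$\mathrm{E}_q[l(X)]-\mathrm{E}_p[l(X)]=\mathrm{E}_q\left[f_l^p(X)\,r(p,q)(X)\right].$$
   Context: $\mathcal{G}$ is the collection of positive real functions $x\mapsto p(x)$ such that (i) the support $S_p := \{x \in \mathbb{R} : p(x) \text{ (exists and) is positive}\}$ is an interval with closure $\bar S_p=[a,b]$ for some $-\infty\le a<b\le\infty$; (ii) $p$ is differentiable (in the usual sense) at every point of $(a,b)$, with derivative $p'$; (iii) $\int_{S_p}p(y)\,dy=1$. Conventions: $\frac{1}{p(x)}$ is understood to be $0$ when $x\notin S_p$; $\mathbb{I}_A$ is the indicator function of $A$; for $p\in\mathcal{G}$, $\mathrm{E}_p[l(X)]:=\int_{S_p}l(x)p(x)\,dx$. The same notation applies with $q$ in place of $p$. For $p\in\mathcal{G}$ with $\bar S_p=[a,b]$, the class of test functions $\mathcal{F}(p)$ is the collection of functions $f:\mathbb{R}\to\mathbb{R}$ such that $x\mapsto f(x)p(x)$ is differentiable on the interior of $S_p$ and $f(a^+)p(a^+)=f(b^-)p(b^-)=0$ (that is, $f(x)p(x)\to 0$ as $x\to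 a^+$ and as $x\to b^-$). The Stein operator $\mathcal{T}_p$ maps $f\in\mathcal{F}(p)$ to the function $\mathcal{T}_pf:\mathbb{R}\to\mathbb{R}$, $\mathcal{T}_pf(x):=\frac{1}{p(x)}\left.\frac{d}{dy}(f(y)p(y))\right|_{y=x}$ (hence $\mathcal{T}_pf(x)=0$ for $x\notin S_p$). For $S_q\subseteq S_p$, $r(p,q)(x):=\left(\frac{p'(x)}{p(x)}-\frac{q'(x)}{q(x)}\right)\mathbb{I}_{S_p}(x)$. *)

theory Defs
  imports "HOL-Analysis.Analysis"
begin

text \<open>Densities are total functions; a point where the density is not defined is a point where
  its value is \<open>0\<close>.\<close>

definition supp :: "(real \<Rightarrow> real) \<Rightarrow> real set" where
  "supp p = {x. p x > 0}"

text \<open>The closure of \<open>S\<close> is \<open>[a,b]\<close> with \<open>-\<infinity> \<le> a < b \<le> \<infinity>\<close>. The pair \<open>(a,b)\<close> is determined by \<open>S\<close>.\<close>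

definition closure_ends :: "real set \<Rightarrow> ereal \<Rightarrow> ereal \<Rightarrow> bool" where
  "closure_ends S a b \<longleftrightarrow> a < b \<and> closure S = {x. a \<le> ereal x \<and> ereal x \<le> b}"

text \<open>Integrals over the support are Henstock--Kurzweil integrals. For nonnegative functions (in
  particular for the normalisation of a density) HK integrability is Lebesgue integrability, and
  for Lebesgue integrable functions in general the two integrals agree; see
  \<open>set_lebesgue_integral_eq_integral\<close>.\<close>

definition dens_class :: "(real \<Rightarrow> real) set" where
  "dens_class = {p. (\<forall>x. 0 \<le> p x) \<and> is_interval (supp p) \<and>
     (\<exists>a b. closure_ends (supp p) a b \<and> (\<forall>x \<in> einterval a b. p differentiable (at x))) \<and>
     (p has_integral 1) (supp p)}"

definition expect_exists :: "(real \<Rightarrow> real) \<Rightarrow> (real \<Rightarrow> real) \<Rightarrow> bool" where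
  "expect_exists p l \<longleftrightarrow> (\<lambda>x. l x * p x) integrable_on supp p"

definition expect :: "(real \<Rightarrow> real) \<Rightarrow> (real \<Rightarrow> real) \<Rightarrow> real" where
  "expect p l = integral (supp p) (\<lambda>x. l x * p x)"

definition recip :: "(real \<Rightarrow> real) \<Rightarrow> real \<Rightarrow> real" where
  "recip p x = (if x \<in> supp p then 1 / p x else 0)"

text \<open>The one-sided limits are taken in \<open>ereal\<close>, as in \<open>interval_integral_FTC_integrable\<close>, so that
  they are limits at \<open>-\<infinity>\<close> or \<open>\<infinity>\<close> when the corresponding endpoint is infinite.\<close>

definition test_class :: "(real \<Rightarrow> real) \<Rightarrow> (real \<Rightarrow> real) set" where
  "test_class p = {f. (\<forall>x \<in> interior (supp p). (\<lambda>y. f y * p y) differentiable (at x)) \<and>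
     (\<exists>a b. closure_ends (supp p) a b \<and>
        (((\<lambda>x. f x * p x) \<circ> real_of_ereal) \<longlongrightarrow> 0) (at_right a) \<and>
        (((\<lambda>x. f x * p x) \<circ> real_of_ereal) \<longlongrightarrow> 0) (at_left b))}"

text \<open>For \<open>f \<in> test_class p\<close> the derivative is only guaranteed to exist in the interior of the
  support; at an endpoint belonging to \<open>supp p\<close> the value may be meaningless.\<close>

definition stein_op :: "(real \<Rightarrow> real) \<Rightarrow> (real \<Rightarrow> real) \<Rightarrow> real \<Rightarrow> real" where
  "stein_op p f x = recip p x * deriv (\<lambda>y. f y * p y) x"

definition score_diff :: "(real \<Rightarrow> real) \<Rightarrow> (real \<Rightarrow> real) \<Rightarrow> real \<Rightarrow> real" where
  "score_diff p q x =
     (deriv p x * recip p x - deriv q x * recip q x) * indicat_real (supp p) x"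

end

theory Submission
  imports Defs
begin

text \<open>On the interior of the support of \<open>q\<close> both densities are positive and differentiable, and the
  two ways of bracketing \<open>f * p * q\<close> have the same derivative. This links the derivatives of
  \<open>f * q\<close> and \<open>f * p\<close> (\<open>deriv_test_mult_change_density\<close>). Replacing the latter by the Stein
  equation \<open>(f * p)' = (l - E\<^sub>p l) * p\<close> and dividing by \<open>p\<close> gives, pointwise,
  \<open>f * (p' / p - q' / q) * q = (l - E\<^sub>p l) * q - (f * q)'\<close>.
  The claim is the integral of this identity over the support of \<open>q\<close>: the first term on the right
  contributes \<open>E\<^sub>q l - E\<^sub>p l\<close>, since \<open>q\<close> has mass \<open>1\<close>, and the second contributes nothing, since
  \<open>f * q\<close> vanishes at both ends of the support (\<open>has_integral_deriv_test_mult\<close>).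

  The derivative \<open>(f * q)'\<close> can fail to be absolutely integrable, so its integral is truly a
  Henstock--Kurzweil integral; that the right-hand side is integrable is what makes the expectation on the left
  exist. The fundamental theorem of calculus needed here
  (\<open>has_integral_einterval_FTC\<close>) covers bounded and unbounded intervals at once: the primitive is
  continued by its limits to a continuous function on the whole line, which is then
  differentiable at all but at most two points.\<close>

section \<open>Fundamental theorem of calculus on extended intervals\<close>

lemma has_integral_UNIV_of_has_field_derivative:
  fixes F F' :: "real \<Rightarrow> real"
  assumes fin: "finite K" and cont: "continuous_on UNIV F"
    and deriv: "\<And>x. x \<notin> K \<Longrightarrow> (F has_field_derivative F' x) (at x)"
    and bot: "(F \<longlongrightarrow> A) at_bot" and top: "(F \<longlongrightarrow> B) at_top"
  shows "(F' has_integral (B - A)) UNIV"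
  unfolding has_integral'[where S = UNIV]
proof (intro allI impI)
  have ftc: "(F' has_integral (F v - F u)) {u..v}" if "u \<le> v" for u v
  proof (rule fundamental_theorem_of_calculus_interior_strong[OF fin that])
    show "(F has_vector_derivative F' x) (at x)" if "x \<in> {u<..<v} - K" for x
      using deriv[of x] that by (simp add: has_real_derivative_iff_has_vector_derivative)
    show "continuous_on {u..v} F"
      by (rule continuous_on_subset[OF cont]) simp
  qed
  fix e :: real
  assume e: "e > 0"
  obtain M where M: "\<And>x. x \<le> M \<Longrightarrow> dist (F x) A < e / 2"
    using tendstoD[OF bot, of "e / 2"] e unfolding eventually_at_bot_linorder by auto
  obtain N where N: "\<And>x. x \<ge> N \<Longrightarrow> dist (F x) B < e / 2"
    using tendstoD[OF top, of "e / 2"] e unfolding eventually_at_top_linorder by auto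
  \<comment> \<open>The bound \<open>1\<close> only serves to make the radius positive.\<close>
  define R where "R = max 1 (max \<bar>M\<bar> \<bar>N\<bar>)"
  show "\<exists>R>0. \<forall>u v. ball 0 R \<subseteq> cbox u v \<longrightarrow>
      (\<exists>z. ((\<lambda>x. if x \<in> UNIV then F' x else 0) has_integral z) (cbox u v) \<and> norm (z - (B - A)) < e)"
  proof (rule exI[of _ R], intro conjI allI impI)
    have R: "R \<ge> 1" "R \<ge> \<bar>M\<bar>" "R \<ge> \<bar>N\<bar>" by (auto simp: R_def)
    then show "R > 0" by simp
    fix u v :: real
    assume sub: "ball 0 R \<subseteq> cbox u v"
    have "cball 0 R \<subseteq> {u..v}"
      using closure_mono[OF sub] \<open>R > 0\<close> by simp
    then have "u \<le> - R" "R \<le> v"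
      using \<open>R > 0\<close> by (auto simp: subset_iff dist_norm)
    then have "u \<le> v" "u \<le> M" "N \<le> v" using R by linarith+
    then have uv: "u \<le> v" "dist (F u) A < e / 2" "dist (F v) B < e / 2"
      using M N by auto
    show "\<exists>z. ((\<lambda>x. if x \<in> UNIV then F' x else 0) has_integral z) (cbox u v) \<and> norm (z - (B - A)) < e"
    proof (intro exI[of _ "F v - F u"] conjI)
      show "norm (F v - F u - (B - A)) < e"
        using uv(2,3) unfolding dist_real_def real_norm_def by linarith
    qed (use ftc[OF uv(1)] in simp)
  qed
qed

text \<open>Continuing the primitive by the constants \<open>A\<close> and \<open>B\<close> turns a finite end into an exceptional
  point of a continuous function, and makes the continued function tend to \<open>A\<close> and \<open>B\<close> at the ends
  of the line, whether \<open>a\<close> and \<open>b\<close> are finite or not.\<close>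

lemma has_integral_einterval_FTC:
  fixes F F' :: "real \<Rightarrow> real"
  assumes ab: "a < b"
    and deriv: "\<And>x. x \<in> einterval a b \<Longrightarrow> (F has_field_derivative F' x) (at x)"
    and A: "((F \<circ> real_of_ereal) \<longlongrightarrow> A) (at_right a)"
    and B: "((F \<circ> real_of_ereal) \<longlongrightarrow> B) (at_left b)"
  shows "(F' has_integral (B - A)) (einterval a b)"
proof -
  define G where "G x = (if ereal x \<le> a then A else if b \<le> ereal x then B else F x)" for x
  define G' where "G' x = (if x \<in> einterval a b then F' x else 0)" for x
  have G_B_beyond: "G y = B" if "b \<le> ereal y" for y
    using that ab by (auto simp: G_def)
  have G_in: "eventually (\<lambda>y. G y = F y) (nhds x)" if "x \<in> einterval a b" for x
    using eventually_nhds_in_open[OF open_einterval that]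
    by (rule eventually_mono) (auto simp: G_def einterval_def)
  have G_lo: "eventually (\<lambda>y. G y = A) (nhds x)" if "ereal x < a" for x
  proof -
    have "x \<in> einterval (-\<infinity>) a" using that by (simp add: einterval_def)
    from eventually_nhds_in_open[OF open_einterval this] show ?thesis
      by (rule eventually_mono) (auto simp: G_def einterval_def)
  qed
  have G_hi: "eventually (\<lambda>y. G y = B) (nhds x)" if "b < ereal x" for x
  proof -
    have "x \<in> einterval b \<infinity>" using that by (simp add: einterval_def)
    from eventually_nhds_in_open[OF open_einterval this] show ?thesis
      by (rule eventually_mono) (simp add: G_B_beyond einterval_def)
  qed
  have deriv_G: "(G has_field_derivative G' x) (at x)" if ne: "ereal x \<noteq> a" "ereal x \<noteq> b" for x
  proof -
    consider "x \<in> einterval a b" | "ereal x < a" | "b < ereal x"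
      using ne unfolding einterval_iff by (meson linorder_less_linear)
    then show ?thesis
    proof cases
      case 1
      then show ?thesis
        using deriv[OF 1] DERIV_cong_ev[OF refl G_in[OF 1] refl] by (simp add: G'_def)
    next
      case 2
      then have "G' x = 0" by (auto simp: G'_def einterval_def)
      then show ?thesis
        using DERIV_cong_ev[OF refl G_lo[OF 2] refl] by simp
    next
      case 3
      then have "G' x = 0" by (auto simp: G'_def einterval_def)
      then show ?thesis
        using DERIV_cong_ev[OF refl G_hi[OF 3] refl] by simp
    qed
  qed
  have ereal_real_between: "ereal (real_of_ereal y) = y" if "a < y" "y < b" for y
    using that by (cases y) auto
  have "eventually (\<lambda>e. (F \<circ> real_of_ereal) e = (G \<circ> real_of_ereal) e) (at_right a)"
    unfolding eventually_at_right[OF ab]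
    by (intro exI[of _ b] conjI ab allI impI) (auto simp: G_def ereal_real_between)
  then have G_A: "((G \<circ> real_of_ereal) \<longlongrightarrow> A) (at_right a)"
    using A by (rule Lim_transform_eventually[rotated])
  have "eventually (\<lambda>e. (F \<circ> real_of_ereal) e = (G \<circ> real_of_ereal) e) (at_left b)"
    unfolding eventually_at_left[OF ab]
    by (intro exI[of _ a] conjI ab allI impI) (auto simp: G_def ereal_real_between)
  then have G_B: "((G \<circ> real_of_ereal) \<longlongrightarrow> B) (at_left b)"
    using B by (rule Lim_transform_eventually[rotated])
  have cont_G: "isCont G x" for x
  proof -
    consider "ereal x = a" | "ereal x = b" | "ereal x \<noteq> a" "ereal x \<noteq> b" by blast
    then show ?thesis
    proof cases
      case 1
      have "(G \<longlongrightarrow> A) (at_right x)"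
        using G_A by (simp add: 1[symmetric] ereal_tendsto_simps1)
      moreover have "(G \<longlongrightarrow> A) (at_left x)"
        by (rule tendsto_eventually)
          (use 1 in \<open>auto simp: G_def eventually_at_filter intro!: always_eventually\<close>)
      moreover have "G x = A" using 1 by (simp add: G_def)
      ultimately show ?thesis
        by (simp add: isCont_def filterlim_split_at_real)
    next
      case 2
      have "(G \<longlongrightarrow> B) (at_left x)"
        using G_B by (simp add: 2[symmetric] ereal_tendsto_simps1)
      moreover have "(G \<longlongrightarrow> B) (at_right x)"
        by (rule tendsto_eventually)
          (use 2 in \<open>auto simp: G_B_beyond eventually_at_filter intro!: always_eventually\<close>)
      moreover have "G x = B" using 2 by (simp add: G_B_beyond)
      ultimately show ?thesis
        by (simp add: isCont_def filterlim_split_at_real)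
    next
      case 3
      then show ?thesis using deriv_G DERIV_isCont by blast
    qed
  qed
  have "(G' has_integral (B - A)) UNIV"
  proof (rule has_integral_UNIV_of_has_field_derivative)
    show "finite {x. ereal x = a \<or> ereal x = b}"
      by (cases a; cases b) auto
    show "continuous_on UNIV G"
      using cont_G by (simp add: continuous_at_imp_continuous_on)
    show "(G has_field_derivative G' x) (at x)" if "x \<notin> {x. ereal x = a \<or> ereal x = b}" for x
      using deriv_G that by blast
    show "(G \<longlongrightarrow> A) at_bot"
    proof (cases a)
      case (real r)
      have "eventually (\<lambda>x. G x = A) at_bot"
        using eventually_le_at_bot[of r] by (rule eventually_mono) (simp add: G_def real)
      then show ?thesis by (rule tendsto_eventually)
    next
      case MInf
      then show ?thesis using G_A by (simp add: ereal_tendsto_simps1)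
    qed (use ab in simp)
    show "(G \<longlongrightarrow> B) at_top"
    proof (cases b)
      case (real r)
      have "eventually (\<lambda>x. G x = B) at_top"
        using eventually_ge_at_top[of r] by (rule eventually_mono) (simp add: G_B_beyond real)
      then show ?thesis by (rule tendsto_eventually)
    next
      case PInf
      then show ?thesis using G_B by (simp add: ereal_tendsto_simps1)
    qed (use ab in simp)
  qed
  then show ?thesis
    unfolding G'_def by (simp add: has_integral_restrict_UNIV)
qed

section \<open>Densities and test functions\<close>

text \<open>Density class and test class each assert the existence of their own pair of ends. Since the ends
  determine the interior, both pairs describe the same open interval.\<close>

lemma interior_eq_einterval:
  assumes "closure_ends S a b" and "is_interval S"
  shows "interior S = einterval a b"
proof -
  have cl: "closure S = {x. a \<le> ereal x \<and> ereal x \<le> b}"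
    using assms(1) by (simp add: closure_ends_def)
  have "interior S = interior (closure S)"
    using assms(2) by (simp add: convex_interior_closure is_interval_convex)
  also have "\<dots> = einterval a b"
  proof (rule interior_unique)
    show "einterval a b \<subseteq> closure S" by (auto simp: cl einterval_def)
    show "T \<subseteq> einterval a b" if "T \<subseteq> closure S" "open T" for T
    proof
      fix x assume "x \<in> T"
      then obtain e where e: "e > 0" "cball x e \<subseteq> T"
        using \<open>open T\<close> open_contains_cball by blast
      then have "x - e \<in> closure S" "x + e \<in> closure S"
        using that(1) by (auto simp: subset_iff dist_real_def)
      then have "a \<le> ereal (x - e)" "ereal (x + e) \<le> b" by (auto simp: cl)
      then show "x \<in> einterval a b"
        using e(1) by (cases a; cases b) (auto simp: einterval_def)
    qed
  qed simp
  finally show ?thesis .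
qed

text \<open>The total increase of \<open>f * q\<close> is \<open>0 - 0\<close> by the boundary condition of the test class. At an end that belongs to
  the support, \<open>deriv\<close> may be arbitrary, but the frontier of an interval is negligible.\<close>

lemma has_integral_deriv_test_mult:
  assumes q: "q \<in> dens_class" and f: "f \<in> test_class q"
  shows "(deriv (\<lambda>y. f y * q y) has_integral 0) (supp q)"
proof -
  obtain a b where ab: "closure_ends (supp q) a b"
    and lim: "(((\<lambda>x. f x * q x) \<circ> real_of_ereal) \<longlongrightarrow> 0) (at_right a)"
      "(((\<lambda>x. f x * q x) \<circ> real_of_ereal) \<longlongrightarrow> 0) (at_left b)"
    and diff: "\<And>x. x \<in> interior (supp q) \<Longrightarrow> (\<lambda>y. f y * q y) differentiable (at x)"
    using f by (auto simp: test_class_def)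
  have int: "interior (supp q) = einterval a b"
    using interior_eq_einterval[OF ab] q by (simp add: dens_class_def)
  have FTC: "(deriv (\<lambda>y. f y * q y) has_integral 0 - 0) (einterval a b)"
  proof (rule has_integral_einterval_FTC[OF _ _ lim])
    show "a < b" using ab by (simp add: closure_ends_def)
    show "((\<lambda>y. f y * q y) has_field_derivative deriv (\<lambda>y. f y * q y) x) (at x)"
      if "x \<in> einterval a b" for x
      using diff[of x] that int by (simp add: DERIV_deriv_iff_real_differentiable)
  qed
  have "negligible (frontier (supp q))"
    using q by (simp add: dens_class_def is_interval_convex negligible_convex_frontier)
  from has_integral_interior[OF this, THEN iffD1] show ?thesis
    using FTC by (simp add: int)
qed

text \<open>Only the products of \<open>f\<close> with the densities are known to be differentiable, so \<open>f * q\<close> and \<open>f * p\<close>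
  are compared through the product rule for \<open>(f * q) * p = (f * p) * q\<close>, without a derivative of \<open>f\<close>.\<close>

lemma deriv_test_mult_change_density:
  fixes f p q :: "real \<Rightarrow> real"
  assumes "p differentiable (at x)" "q differentiable (at x)"
    and "(\<lambda>y. f y * p y) differentiable (at x)" "(\<lambda>y. f y * q y) differentiable (at x)"
  shows "deriv (\<lambda>y. f y * q y) x * p x + f x * q x * deriv p x =
    deriv (\<lambda>y. f y * p y) x * q x + f x * p x * deriv q x"
proof -
  note D = assms[folded DERIV_deriv_iff_real_differentiable]
  have "((\<lambda>y. (f y * q y) * p y) has_field_derivative
      deriv (\<lambda>y. f y * q y) x * p x + deriv p x * (f x * q x)) (at x)"
    by (rule DERIV_mult[OF D(4) D(1)])
  moreover have "((\<lambda>y. (f y * p y) * q y) has_field_derivative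
      deriv (\<lambda>y. f y * p y) x * q x + deriv q x * (f x * p x)) (at x)"
    by (rule DERIV_mult[OF D(3) D(2)])
  moreover have "(\<lambda>y. (f y * p y) * q y) = (\<lambda>y. (f y * q y) * p y)"
    by (simp add: mult_ac)
  ultimately show ?thesis
    using DERIV_unique by (fastforce simp: mult_ac)
qed

lemma differentiable_interior_supp:
  assumes "p \<in> dens_class" "x \<in> interior (supp p)"
  shows "p differentiable (at x)"
  using assms interior_eq_einterval by (auto simp: dens_class_def)

section \<open>Comparison of expectations\<close>

theorem lemma3p2:
  fixes p q l f :: "real \<Rightarrow> real"
  assumes "p \<in> dens_class" and "q \<in> dens_class"
    and "supp q \<subseteq> supp p"
    and "expect_exists p l" and "expect_exists q l"
    and "f \<in> test_class p \<inter> test_class q"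
    and "\<And>x. x \<notin> supp p - interior (supp p) \<Longrightarrow>
           stein_op p f x = (l x - expect p l) * indicat_real (supp p) x"
  shows "expect_exists q (\<lambda>x. f x * score_diff p q x) \<and>
         expect q l - expect p l = expect q (\<lambda>x. f x * score_diff p q x)"
proof -
  define m where "m = expect p l"
  define g where "g x = l x * q x - m * q x - deriv (\<lambda>y. f y * q y) x" for x
  have null: "negligible (frontier (supp q))"
    using assms(2) by (simp add: dens_class_def is_interval_convex negligible_convex_frontier)
  have "(g has_integral expect q l - m * 1 - 0) (supp q)"
    unfolding g_def
  proof (intro has_integral_diff has_integral_mult_right)
    show "((\<lambda>x. l x * q x) has_integral expect q l) (supp q)"
      using assms(5) by (simp add: expect_exists_def expect_def integrable_integral)
    show "(q has_integral 1) (supp q)"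
      using assms(2) by (simp add: dens_class_def)
    show "(deriv (\<lambda>y. f y * q y) has_integral 0) (supp q)"
      using has_integral_deriv_test_mult assms(2,6) by simp
  qed
  then have g_int: "(g has_integral expect q l - m) (supp q)" by simp
  \<comment> \<open>\<open>g\<close> is the integrand of the claim off the frontier, where the derivatives are available.\<close>
  have "((\<lambda>x. f x * score_diff p q x * q x) has_integral expect q l - m) (supp q)"
  proof (rule has_integral_spike[OF null _ g_int])
    fix x assume "x \<in> supp q - frontier (supp q)"
    then have xq: "x \<in> interior (supp q)"
      using closure_subset by (auto simp: frontier_def)
    then have xp: "x \<in> interior (supp p)"
      using interior_mono[OF assms(3)] by blast
    have pos: "x \<in> supp p" "x \<in> supp q" "p x > 0" "q x > 0"
      using xq xp interior_subset[of "supp q"] interior_subset[of "supp p"]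
      by (auto simp: supp_def)
    have diff: "p differentiable (at x)" "q differentiable (at x)"
      "(\<lambda>y. f y * p y) differentiable (at x)" "(\<lambda>y. f y * q y) differentiable (at x)"
      using assms(1,2,6) xp xq differentiable_interior_supp by (auto simp: test_class_def)
    have stein: "deriv (\<lambda>y. f y * p y) x = (l x - m) * p x"
      using assms(7)[of x] xp pos by (simp add: stein_op_def recip_def m_def field_simps)
    have "deriv (\<lambda>y. f y * q y) x =
        (l x - m) * q x + f x * deriv q x - f x * q x * deriv p x / p x"
      using deriv_test_mult_change_density[OF diff] pos unfolding stein
      by (simp add: field_simps)
    moreover have "f x * score_diff p q x * q x = f x * q x * deriv p x / p x - f x * deriv q x"
      using pos by (simp add: score_diff_def recip_def field_simps)
    ultimately show "f x * score_diff p q x * q x = g x"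
      by (simp add: g_def left_diff_distrib)
  qed
  then show ?thesis
    by (auto simp: expect_exists_def expect_def[of q "\<lambda>x. f x * score_diff p q x"] m_def
        dest: integral_unique intro: has_integral_integrable)
qed

end
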